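(* Let $m\geq1$ and let $f\in\mathbb{R}[x]$ be a polynomial of odd degree $2m+1\geq3$ with positive leading coefficient such that $f'$ has only real and simple zeros $z_1<\cdots<z_{2m}$. Let $x_0<z_1$ and $x_1>z_{2m}$ be (real) fixed points of $f$ such that $f(z_{2i})\leq x_0$ and $f(z_{2i-1})\geq x_1$ for all $i=1,\ldots,m$. Then $f$ has only real periodic points.
   Context: A polynomial $f$ is regarded as a map of the Riemann sphere $\overline{\mathbb{C}}=\mathbb{C}\cup\{\infty\}$ to itself (with $f(\infty)=\infty$). Iterates are $f^1=f$, $f^{k+1}=f^k\circ f$. "$f$ has only real periodic points" means that for all $k\geq1$ every solution $z\in\overline{\mathbb{C}}$ of $f^k(z)=z$ lies in $\overline{\mathbb{R}}=\mathbb{R}\cup\{\infty\}$. *)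

theory Defs
  imports Complex_Main "HOL-Computational_Algebra.Polynomial"
begin

datatype riemann_sphere = Finite complex | Infinity

(* The value at Infinity is the correct one for non-constant polynomials only. *)
fun sphere_map :: "complex poly \<Rightarrow> riemann_sphere \<Rightarrow> riemann_sphere" where
  "sphere_map p (Finite z) = Finite (poly p z)"
| "sphere_map p Infinity = Infinity"

definition extended_real_line :: "riemann_sphere set" where
  "extended_real_line = Finite ` \<real> \<union> {Infinity}"

definition only_real_periodic_points :: "complex poly \<Rightarrow> bool" where
  "only_real_periodic_points p \<longleftrightarrow>
     (\<forall>k\<ge>1. \<forall>z. (sphere_map p ^^ k) z = z \<longrightarrow> z \<in> extended_real_line)"

abbreviation complex_poly :: "real poly \<Rightarrow> complex poly" where
  "complex_poly f \<equiv> map_poly complex_of_real f"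

end

(* The critical points cut [x0, x1] into 2m + 1 intervals, each of which f maps over all of [x0, x1].
   Pulling laps back through these intervals, f^k has (2m + 1)^k non-overlapping laps, i.e. intervals
   whose end points are sent to x0 and x1. By the intermediate value theorem each lap contains a
   fixed point of f^k, and no fixed point lies in two laps. As f^k - id has degree (2m + 1)^k, these
   real points are all its complex zeros. *)

theory Submission
  imports Defs
begin

section \<open>Monotone right inverses of a map covering an interval\<close>

text \<open>Since \<open>f\<close> may oscillate on \<open>{c..d}\<close>, one solution is chosen:
  \<open>s y\<close> is the largest point of \<open>{c..d}\<close> where \<open>f\<close> is at most
  \<open>y\<close>. The sets \<open>S y\<close> grow with \<open>y\<close>, hence so do their
  maxima.\<close>

lemma increasing_section:
  fixes f :: "real \<Rightarrow> real"
  assumes "c \<le> d" and cont: "continuous_on {c..d} f" and fc: "f c \<le> a" and fd: "b \<le> f d"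
  obtains s where "\<And>y. y \<in> {a..b} \<Longrightarrow> s y \<in> {c..d} \<and> f (s y) = y" and "mono_on {a..b} s"
proof -
  define S where "S y = {t \<in> {c..d}. f t \<le> y}" for y
  have ex: "\<exists>t\<in>S y. (\<forall>u\<in>S y. u \<le> t) \<and> f t = y" if y: "y \<in> {a..b}" for y
  proof -
    have S_eq: "S y = f -` {..y} \<inter> {c..d}" by (auto simp: S_def)
    then have "closed (S y)"
      using cont by (simp add: continuous_on_closed_vimage)
    then have "compact ({c..d} \<inter> S y)"
      by (intro compact_Int_closed compact_Icc)
    moreover have "{c..d} \<inter> S y = S y" using S_eq by blast
    moreover have "c \<in> S y" using assms y by (auto simp: S_def)
    ultimately obtain t where t: "t \<in> S y" "\<forall>u\<in>S y. u \<le> t"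
      using compact_attains_sup[of "S y"] by auto
    \<comment> \<open>If \<open>f t\<close> were below \<open>y\<close>, a solution further right
      would contradict the maximality of \<open>t\<close>.\<close>
    have "\<exists>u\<ge>t. u \<le> d \<and> f u = y"
      by (rule IVT') (use t y fd in \<open>auto simp: S_def intro: continuous_on_subset[OF cont]\<close>)
    then obtain u where u: "t \<le> u" "u \<le> d" "f u = y" by blast
    with t have "u \<in> S y" by (auto simp: S_def)
    with t u have "u = t" by force
    with t u show ?thesis by blast
  qed
  then obtain s where s: "\<And>y. y \<in> {a..b} \<Longrightarrow> s y \<in> S y \<and> (\<forall>u\<in>S y. u \<le> s y) \<and> f (s y) = y"
    by metis
  show thesis
  proof
    show "s y \<in> {c..d} \<and> f (s y) = y" if "y \<in> {a..b}" for y
      using s[OF that] by (auto simp: S_def)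
    show "mono_on {a..b} s"
    proof (rule mono_onI)
      fix y y' assume *: "y \<in> {a..b}" "y' \<in> {a..b}" "y \<le> y'"
      then have "s y \<in> S y'" using s[of y] by (auto simp: S_def)
      then show "s y \<le> s y'" using s[of y'] * by blast
    qed
  qed
qed

text \<open>Reflecting the domain by \<open>t\<close> to \<open>- t\<close> turns the second
  alternative into the first; negating the section obtained makes it antimonotone.\<close>

lemma monotone_section:
  fixes f :: "real \<Rightarrow> real"
  assumes "c \<le> d" and cont: "continuous_on {c..d} f"
    and "f c \<le> a \<and> b \<le> f d \<or> f d \<le> a \<and> b \<le> f c"
  obtains s where "\<And>y. y \<in> {a..b} \<Longrightarrow> s y \<in> {c..d} \<and> f (s y) = y"
    and "mono_on {a..b} s \<or> antimono_on {a..b} s"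
  using assms(3)
proof
  assume "f c \<le> a \<and> b \<le> f d"
  then show thesis using increasing_section[OF assms(1) cont] that by blast
next
  assume *: "f d \<le> a \<and> b \<le> f c"
  have "continuous_on {-d..-c} (\<lambda>t. f (- t))"
    by (rule continuous_on_compose2[OF cont]) (auto intro!: continuous_intros)
  from increasing_section[OF _ this, of a b] * assms(1)
  obtain s where s: "\<And>y. y \<in> {a..b} \<Longrightarrow> s y \<in> {-d..-c} \<and> f (- s y) = y"
    and m: "mono_on {a..b} s" by auto
  show thesis
  proof (rule that)
    show "- s y \<in> {c..d} \<and> f (- s y) = y" if "y \<in> {a..b}" for y
      using s[OF that] by auto
    show "mono_on {a..b} (\<lambda>y. - s y) \<or> antimono_on {a..b} (\<lambda>y. - s y)"
      using m by (auto simp: monotone_on_def)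
  qed
qed

section \<open>Laps and their pull-back\<close>

(* The end points are ordered by their images, not by their position: (u, v) may have v < u. *)
definition lap :: "real \<Rightarrow> real \<Rightarrow> (real \<Rightarrow> real) \<Rightarrow> real \<times> real \<Rightarrow> bool" where
  "lap a b g P \<longleftrightarrow>
     fst P \<in> {a..b} \<and> snd P \<in> {a..b} \<and> g (fst P) = a \<and> g (snd P) = b"

text \<open>The inequality is weak because neighbouring laps may share an end point.\<close>

definition left_of :: "real \<times> real \<Rightarrow> real \<times> real \<Rightarrow> bool" where
  "left_of P Q \<longleftrightarrow> max (fst P) (snd P) \<le> min (fst Q) (snd Q)"

definition laps :: "real \<Rightarrow> real \<Rightarrow> (real \<Rightarrow> real) \<Rightarrow> (real \<times> real) set \<Rightarrow> bool" where
  "laps a b g S \<longleftrightarrow> (\<forall>P\<in>S. lap a b g P) \<and>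
     (\<forall>P\<in>S. \<forall>Q\<in>S. P \<noteq> Q \<longrightarrow> left_of P Q \<or> left_of Q P)"

text \<open>Each lap of \<open>g\<close> is pulled back through each section \<open>s i\<close>.
  Different sections land in different intervals \<open>{c i..c (Suc i)}\<close>, and a single
  section preserves or reverses the order of laps.\<close>

lemma laps_compose:
  assumes ab: "a < b"
    and s: "\<And>i y. i < n \<Longrightarrow> y \<in> {a..b} \<Longrightarrow> s i y \<in> {c i..c (Suc i)} \<and> f (s i y) = y"
    and m: "\<And>i. i < n \<Longrightarrow> mono_on {a..b} (s i) \<or> antimono_on {a..b} (s i)"
    and c: "\<And>i j. i \<le> j \<Longrightarrow> j \<le> n \<Longrightarrow> c i \<le> c j" and c0: "c 0 = a" and cn: "c n = b"
    and S: "laps a b g S"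
  shows "\<exists>T. laps a b (g \<circ> f) T \<and> card T = n * card S"
proof -
  define F where "F = (\<lambda>(i, P). (s i (fst P), s i (snd P)))"
  let ?I = "{..<n} \<times> S"
  have lapS: "fst P \<in> {a..b}" "snd P \<in> {a..b}" "g (fst P) = a" "g (snd P) = b" if "P \<in> S" for P
    using S that by (auto simp: laps_def lap_def)
  have lapF: "lap a b (g \<circ> f) (F (i, P))" if "i < n" "P \<in> S" for i P
    using s[OF that(1) lapS(1)[OF that(2)]] s[OF that(1) lapS(2)[OF that(2)]]
      lapS[OF that(2)] c[of 0 i] c[of "Suc i" n] that(1) c0 cn
    by (auto simp: lap_def F_def)
  have less: "left_of (F (i, P)) (F (j, Q))" if "i < j" "j < n" "P \<in> S" "Q \<in> S" for i j P Q
  proof -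
    have "i < n" using that by simp
    then show ?thesis
      using s[OF _ lapS(1)[OF that(3)], of i] s[OF _ lapS(2)[OF that(3)], of i]
        s[OF that(2) lapS(1)[OF that(4)]] s[OF that(2) lapS(2)[OF that(4)]] c[of "Suc i" j] that
      by (auto simp: left_of_def F_def)
  qed
  have same: "left_of (F (i, P)) (F (i, Q)) \<or> left_of (F (i, Q)) (F (i, P))"
    if "i < n" "P \<in> S" "Q \<in> S" "left_of P Q" for i P Q
    using m[OF that(1)] lapS(1,2)[OF that(2)] lapS(1,2)[OF that(3)] that(4)
    by (auto simp: left_of_def F_def monotone_on_def)
  have sep: "left_of (F x) (F y) \<or> left_of (F y) (F x)" if xy: "x \<in> ?I" "y \<in> ?I" "x \<noteq> y" for x y
  proof -
    obtain i P j Q where xy_eq: "x = (i, P)" "y = (j, Q)"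
      by (cases x, cases y) blast
    consider "i < j" | "j < i" | "i = j" "P \<noteq> Q"
      using xy xy_eq by fastforce
    then show ?thesis
    proof cases
      case 3
      with S xy xy_eq have "left_of P Q \<or> left_of Q P" by (auto simp: laps_def)
      with 3 same[of i P Q] same[of i Q P] xy xy_eq show ?thesis by auto
    qed (use less xy xy_eq in auto)
  qed
  have "inj_on F ?I"
  proof (rule inj_onI, rule ccontr)
    fix x y assume *: "x \<in> ?I" "y \<in> ?I" "F x = F y" "x \<noteq> y"
    then have "lap a b (g \<circ> f) (F x)" using lapF by auto
    \<comment> \<open>Two equal images would make a lap lie left of itself, so its end points would
      coincide, although they are sent to \<open>a\<close> and \<open>b\<close>.\<close>
    then have "fst (F x) \<noteq> snd (F x)" using ab by (auto simp: lap_def)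
    with sep[of x y] * show False by (auto simp: left_of_def)
  qed
  then have "card (F ` ?I) = n * card S" by (simp add: card_image card_cartesian_product)
  moreover have "laps a b (g \<circ> f) (F ` ?I)"
    unfolding laps_def
  proof (intro conjI ballI impI)
    show "lap a b (g \<circ> f) R" if "R \<in> F ` ?I" for R
      using that lapF by auto
    show "left_of R R' \<or> left_of R' R" if "R \<in> F ` ?I" "R' \<in> F ` ?I" "R \<noteq> R'" for R R'
    proof -
      obtain x y where "x \<in> ?I" "R = F x" "y \<in> ?I" "R' = F y"
        using \<open>R \<in> F ` ?I\<close> \<open>R' \<in> F ` ?I\<close> by (elim imageE)
      with sep[of x y] \<open>R \<noteq> R'\<close> show ?thesis by blast
    qed
  qed
  ultimately show ?thesis by blast
qed

text \<open>Each of the \<open>n\<close> intervals between consecutive \<open>c i\<close> covers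
  \<open>{a..b}\<close> under \<open>f\<close>, so every pull-back multiplies the number of laps by
  \<open>n\<close>, starting from the single lap \<open>(a, b)\<close> of the identity.\<close>

lemma laps_iterate:
  fixes f :: "real \<Rightarrow> real"
  assumes ab: "a < b" and cont: "continuous_on UNIV f"
    and c: "\<And>i. i < n \<Longrightarrow> c i \<le> c (Suc i)" and c0: "c 0 = a" and cn: "c n = b"
    and fc: "\<And>i. i \<le> n \<Longrightarrow> if even i then f (c i) \<le> a else b \<le> f (c i)"
  shows "\<exists>S. laps a b (f ^^ k) S \<and> card S = n ^ k"
proof (induction k)
  case 0
  have "laps a b (f ^^ 0) {(a, b)}" using ab by (auto simp: laps_def lap_def)
  then show ?case by (intro exI[of _ "{(a, b)}"]) (simp add: id_def)
next
  case (Suc k)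
  have "\<exists>s. (\<forall>y\<in>{a..b}. s y \<in> {c i..c (Suc i)} \<and> f (s y) = y) \<and>
            (mono_on {a..b} s \<or> antimono_on {a..b} s)" if "i < n" for i
  proof -
    have "f (c i) \<le> a \<and> b \<le> f (c (Suc i)) \<or> f (c (Suc i)) \<le> a \<and> b \<le> f (c i)"
      using fc[of i] fc[of "Suc i"] that by (auto split: if_splits)
    from monotone_section[OF c[OF that] continuous_on_subset[OF cont] this]
    show ?thesis by (metis subset_UNIV)
  qed
  then obtain s where s: "\<And>i y. i < n \<Longrightarrow> y \<in> {a..b} \<Longrightarrow> s i y \<in> {c i..c (Suc i)} \<and> f (s i y) = y"
    and m: "\<And>i. i < n \<Longrightarrow> mono_on {a..b} (s i) \<or> antimono_on {a..b} (s i)"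
    by metis
  have mono_c: "c i \<le> c j" if "i \<le> j" "j \<le> n" for i j
    using that
  proof (induction rule: dec_induct)
    case (step j)
    then show ?case using c[of j] by linarith
  qed simp
  from Suc obtain S where "laps a b (f ^^ k) S" "card S = n ^ k" by blast
  with laps_compose[OF ab s m mono_c c0 cn, of "f ^^ k" S]
  have "\<exists>T. laps a b ((f ^^ k) \<circ> f) T \<and> card T = n * n ^ k" by simp
  \<comment> \<open>The new factor \<open>f\<close> is the one applied first, as the pull-back
    requires.\<close>
  then show ?case
    unfolding funpow_Suc_right power_Suc .
qed

section \<open>Fixed points in laps\<close>

text \<open>As the end points lie in \<open>{a..b}\<close> and are sent to \<open>a\<close> and
  \<open>b\<close>, the difference of \<open>g\<close> and the identity changes sign between
  them.\<close>

lemma lap_fixed_point: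
  assumes "lap a b g P" and cont: "continuous_on UNIV g"
  shows "\<exists>p\<in>{min (fst P) (snd P)..max (fst P) (snd P)}. g p = p"
proof -
  obtain u v where P: "P = (u, v)" by fastforce
  have uv: "g u \<le> u" "v \<le> g v" using assms(1) by (auto simp: lap_def P)
  show ?thesis
  proof (cases "u \<le> v")
    case True
    have "\<exists>p\<ge>u. p \<le> v \<and> g p - p = 0"
      by (rule IVT') (use True uv in
        \<open>auto intro!: continuous_intros continuous_on_subset[OF cont]\<close>)
    then show ?thesis by (auto simp: P min_def max_def)
  next
    case False
    have "\<exists>p\<ge>v. p \<le> u \<and> g p - p = 0"
      by (rule IVT2') (use False uv in
        \<open>auto intro!: continuous_intros continuous_on_subset[OF cont]\<close>)
    then show ?thesis using False by (auto simp: P min_def max_def)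
  qed
qed

lemma laps_fixed_points:
  assumes ab: "a < b" and cont: "continuous_on UNIV g" and S: "laps a b g S"
  shows "\<exists>T \<subseteq> {p. g p = p}. card T = card S"
proof -
  have "\<forall>P\<in>S. \<exists>p\<in>{min (fst P) (snd P)..max (fst P) (snd P)}. g p = p"
    using S lap_fixed_point[OF _ cont] by (auto simp: laps_def)
  then obtain \<phi> where \<phi>: "\<And>P. P \<in> S \<Longrightarrow>
      \<phi> P \<in> {min (fst P) (snd P)..max (fst P) (snd P)} \<and> g (\<phi> P) = \<phi> P"
    by metis
  (* A common fixed point would be an end point of both laps, hence a or b; but a cannot be the
     right end of a lap and b cannot be the left end. *)
  have ne: "\<phi> P \<noteq> \<phi> Q" if PQ: "P \<in> S" "Q \<in> S" "left_of P Q" for P Q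
  proof
    assume eq: "\<phi> P = \<phi> Q"
    have P: "lap a b g P" and Q: "lap a b g Q" using S PQ by (auto simp: laps_def)
    have max: "\<phi> P = max (fst P) (snd P)" and min: "\<phi> P = min (fst Q) (snd Q)"
      using \<phi>[OF PQ(1)] \<phi>[OF PQ(2)] PQ(3) eq by (auto simp: left_of_def)
    have "\<phi> P = fst P \<or> \<phi> P = snd P" using max by (auto simp: max_def)
    \<comment> \<open>A fixed end point equals its own image, which is \<open>a\<close> or
      \<open>b\<close>.\<close>
    then have "\<phi> P = a \<or> \<phi> P = b" using \<phi>[OF PQ(1)] P by (auto simp: lap_def)
    then show False
    proof
      assume "\<phi> P = a"
      with max P have "fst P = a" "snd P = a" by (auto simp: lap_def)
      with P ab show False by (auto simp: lap_def)
    next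
      assume "\<phi> P = b"
      with min Q have "fst Q = b" "snd Q = b" by (auto simp: lap_def)
      with Q ab show False by (auto simp: lap_def)
    qed
  qed
  have "inj_on \<phi> S"
  proof (rule inj_onI, rule ccontr)
    fix P Q assume *: "P \<in> S" "Q \<in> S" "\<phi> P = \<phi> Q" "P \<noteq> Q"
    then have "left_of P Q \<or> left_of Q P" using S by (auto simp: laps_def)
    with ne[of P Q] ne[of Q P] * show False by auto
  qed
  then have "card (\<phi> ` S) = card S" by (rule card_image)
  then show ?thesis using \<phi> by (intro exI[of _ "\<phi> ` S"]) auto
qed

section \<open>Counting fixed points of polynomial iterates\<close>

lemma fixed_points_poly_iterate:
  fixes p :: "'a::idom poly"
  assumes "degree p \<ge> 2" and "k \<ge> 1"
  shows "finite {z. (poly p ^^ k) z = z}" and "card {z. (poly p ^^ k) z = z} \<le> degree p ^ k"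
proof -
  define q where "q = (pcompose p ^^ k) [:0, 1:]"
  have poly_q: "poly q z = (poly p ^^ k) z" for z
    unfolding q_def by (induction k) (auto simp: poly_pcompose)
  have deg_q: "degree q = degree p ^ k"
    unfolding q_def by (induction k) (auto simp: degree_pcompose)
  \<comment> \<open>Subtracting the identity polynomial then leaves the degree of \<open>q\<close>
    unchanged, so the difference is nonzero and has at most \<open>degree q\<close> roots.\<close>
  have "degree [:0, 1:: 'a:] < degree q"
    using assms self_le_power[of "degree p" k] by (simp add: deg_q)
  then have "degree (q - [:0, 1:]) = degree q"
    using degree_add_eq_left[of "- [:0, 1:]" q] by (simp only: degree_minus diff_conv_add_uminus)
  moreover from this have "q - [:0, 1:] \<noteq> 0"
    using \<open>degree [:0, 1:: 'a:] < degree q\<close> by auto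
  moreover have "{z. (poly p ^^ k) z = z} = {z. poly (q - [:0, 1:]) z = 0}"
    by (simp add: poly_q)
  ultimately show "finite {z. (poly p ^^ k) z = z}" "card {z. (poly p ^^ k) z = z} \<le> degree p ^ k"
    using poly_roots_finite card_poly_roots_bound deg_q by metis+
qed

text \<open>The given real fixed points already reach the degree bound on the number of complex
  ones, so they exhaust them; \<open>Infinity\<close> belongs to the extended real line.\<close>

lemma only_real_periodic_pointsI:
  fixes f :: "real poly"
  assumes "degree f \<ge> 2"
    and "\<And>k. k \<ge> 1 \<Longrightarrow> \<exists>T \<subseteq> {x. (poly f ^^ k) x = x}. card T = degree f ^ k"
  shows "only_real_periodic_points (complex_poly f)"
  unfolding only_real_periodic_points_def
proof (intro allI impI)
  fix k :: nat and z
  assume k: "k \<ge> 1" and z: "(sphere_map (complex_poly f) ^^ k) z = z"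
  have deg: "degree (complex_poly f) = degree f" by (simp add: degree_map_poly)
  have iter: "(sphere_map p ^^ k) (Finite w) = Finite ((poly p ^^ k) w)" for p w
    by (induction k) auto
  have "poly (complex_poly f) (of_real x) = of_real (poly f x)" for x
    by (simp add: poly_altdef degree_map_poly coeff_map_poly)
  then have real: "(poly (complex_poly f) ^^ k) (of_real x) = of_real ((poly f ^^ k) x)" for x
    by (induction k) auto
  obtain T where T: "T \<subseteq> {x. (poly f ^^ k) x = x}" "card T = degree f ^ k"
    using assms(2)[OF k] by blast
  let ?Z = "{w. (poly (complex_poly f) ^^ k) w = w}"
  have "complex_of_real ` T \<subseteq> ?Z" using T(1) real by auto
  moreover have "card (complex_of_real ` T) = degree f ^ k"
    using T(2) by (simp add: card_image inj_on_def)
  ultimately have "complex_of_real ` T = ?Z"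
    using fixed_points_poly_iterate[of "complex_poly f" k] assms(1) k deg
    by (intro card_seteq) simp_all
  have "w \<in> \<real>" if "(poly (complex_poly f) ^^ k) w = w" for w
  proof -
    have "w \<in> complex_of_real ` T" using \<open>complex_of_real ` T = ?Z\<close> that by simp
    then show ?thesis by (elim imageE) simp
  qed
  then show "z \<in> extended_real_line"
    using z by (cases z) (auto simp: extended_real_line_def iter)
qed

section \<open>Laps cut out by the critical points\<close>

theorem corollary4:
  fixes f :: "real poly" and m :: nat and z :: "nat \<Rightarrow> real" and x0 x1 :: real
  assumes "m \<ge> 1"
    and "degree f = 2 * m + 1"
    and "lead_coeff f > 0"
    and "strict_mono_on {1..2 * m} z"
    and "{w. poly (complex_poly (pderiv f)) w = 0} = (\<lambda>i. complex_of_real (z i)) ` {1..2 * m}"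
    and "\<forall>w. poly (complex_poly (pderiv f)) w = 0 \<longrightarrow> order w (complex_poly (pderiv f)) = 1"
    and "poly f x0 = x0" and "x0 < z 1"
    and "poly f x1 = x1" and "x1 > z (2 * m)"
    and "\<forall>i\<in>{1..m}. poly f (z (2 * i)) \<le> x0 \<and> poly f (z (2 * i - 1)) \<ge> x1"
  shows "only_real_periodic_points (complex_poly f)"
proof (rule only_real_periodic_pointsI)
  show "degree f \<ge> 2" using assms(1,2) by simp
  \<comment> \<open>Adding \<open>x0\<close> and \<open>x1\<close> as outermost points gives
    \<open>2 * m + 1\<close> intervals, as many as the degree of \<open>f\<close>.\<close>
  define c where "c i = (if i = 0 then x0 else if i = 2 * m + 1 then x1 else z i)" for i
  have "z 1 \<le> z (2 * m)"
    using assms(1) strict_mono_on_leD[OF assms(4), of 1 "2 * m"] by simp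
  then have x01: "x0 < x1" using assms(8,10) by simp
  have c_le: "c i \<le> c (Suc i)" if i: "i < 2 * m + 1" for i
  proof -
    consider "i = 0" | "i = 2 * m" | "1 \<le> i" "i < 2 * m" using i by linarith
    then show ?thesis
    proof cases
      case 3
      then show ?thesis
        using strict_mono_on_leD[OF assms(4), of i "Suc i"] by (simp add: c_def)
    qed (use assms(1,8,10) in \<open>auto simp: c_def\<close>)
  qed
  have fc: "if even i then poly f (c i) \<le> x0 else x1 \<le> poly f (c i)" if i: "i \<le> 2 * m + 1" for i
  proof (cases "i = 0 \<or> i = 2 * m + 1")
    case True
    \<comment> \<open>The fixed points fit the parity pattern: \<open>x0\<close> has the even index
      0 and \<open>x1\<close> the odd index \<open>2 * m + 1\<close>.\<close>
    then show ?thesis using assms(7,9) by (auto simp: c_def)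
  next
    case False
    show ?thesis
    proof (cases "even i")
      case True
      then obtain j where "i = 2 * j" by (elim evenE)
      with assms(11) False i show ?thesis by (auto simp: c_def)
    next
      case odd: False
      then obtain j where j: "i = 2 * j + 1" by (elim oddE)
      \<comment> \<open>The hypothesis writes odd indices as \<open>2 * i - 1\<close> with
        \<open>i\<close> starting at 1, hence the shift from \<open>j\<close> to
        \<open>Suc j\<close>.\<close>
      with False i have "Suc j \<in> {1..m}" by auto
      with assms(11) have "x1 \<le> poly f (z (2 * Suc j - 1))" by blast
      with j False odd show ?thesis by (simp add: c_def)
    qed
  qed
  fix k :: nat
  have cont: "continuous_on UNIV (poly f)" by (intro continuous_intros)
  have "\<exists>S. laps x0 x1 (poly f ^^ k) S \<and> card S = (2 * m + 1) ^ k"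
    using laps_iterate[OF x01 cont c_le _ _ fc] by (simp add: c_def)
  moreover have "continuous_on UNIV (poly f ^^ k)"
    by (induction k) (auto intro!: continuous_intros simp: comp_def)
  ultimately show "\<exists>T \<subseteq> {x. (poly f ^^ k) x = x}. card T = degree f ^ k"
    using laps_fixed_points[OF x01] assms(2) by metis
qed

end
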